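(* For every positive rational $\epsilon$, there are $2^{\aleph_0}$ many reals $x\in 2^\omega$ that are $h$-jump traceable for $h(n)=n^{1+\epsilon}$.
   Context: For an order function $h$ (computable, nondecreasing, unbounded), a real $x$ is $h$-jump traceable if for each Turing functional $\Phi$ there is a uniformly c.e. sequence of finite sets $(U_n)$ with $|U_n|\le h(n)$ for all $n$ such that, if $\Phi^x$ is total, then $\Phi^x(n)\in U_n$ for almost every $n$. *)

theory Defs
  imports Complex_Main "HOL-Library.Equipollence"
begin

text \<open>Codes of partial recursive functions relative to an oracle-function f :: nat => nat.
  Arguments are lists of naturals; arity is implicit.\<close>
datatype recf =
    Zero
  | Succ
  | Proj nat
  | Orc
  | Comp recf "recf list"
  | Prim recf recf
  | Mn recf

lemma list_all2_mono_pred [mono]: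
  "(\<And>x y. P x y \<longrightarrow> Q x y) \<Longrightarrow> list_all2 P xs ys \<longrightarrow> list_all2 Q xs ys"
  by (auto elim: list_all2_mono)

inductive eval :: "(nat \<Rightarrow> nat) \<Rightarrow> recf \<Rightarrow> nat list \<Rightarrow> nat \<Rightarrow> bool" where
  zero: "eval f Zero xs 0"
| succ: "eval f Succ (x # xs) (Suc x)"
| proj: "i < length xs \<Longrightarrow> eval f (Proj i) xs (xs ! i)"
| orc:  "eval f Orc (x # xs) (f x)"
| comp: "list_all2 (\<lambda>h y. eval f h xs y) hs ys \<Longrightarrow> eval f g ys z \<Longrightarrow> eval f (Comp g hs) xs z"
| prim0: "eval f g xs y \<Longrightarrow> eval f (Prim g h) (0 # xs) y"
| primS: "eval f (Prim g h) (n # xs) y \<Longrightarrow> eval f h (y # n # xs) z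
          \<Longrightarrow> eval f (Prim g h) (Suc n # xs) z"
| mn: "eval f g (n # xs) 0 \<Longrightarrow> (\<forall>m<n. \<exists>y. y \<noteq> 0 \<and> eval f g (m # xs) y)
          \<Longrightarrow> eval f (Mn g) xs n"

definition orac_of :: "(nat \<Rightarrow> bool) \<Rightarrow> nat \<Rightarrow> nat" where
  "orac_of x = (\<lambda>n. if x n then 1 else 0)"

definition Phi :: "recf \<Rightarrow> (nat \<Rightarrow> bool) \<Rightarrow> nat \<Rightarrow> nat \<Rightarrow> bool" where
  "Phi e x n y \<longleftrightarrow> eval (orac_of x) e [n] y"

text \<open>The n-th set of the uniformly c.e. sequence coded by c (no oracle used; constant 0 oracle-function):
  U_n = {y. the computation of c on (n, y) halts}.\<close>
definition ce_seq :: "recf \<Rightarrow> nat \<Rightarrow> nat set" where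
  "ce_seq c n = {y. \<exists>z. eval (\<lambda>_. 0) c [n, y] z}"

definition jump_traceable :: "(nat \<Rightarrow> real) \<Rightarrow> (nat \<Rightarrow> bool) \<Rightarrow> bool" where
  "jump_traceable h x \<longleftrightarrow>
     (\<forall>e. \<exists>c. (\<forall>n. finite (ce_seq c n) \<and> real (card (ce_seq c n)) \<le> h n) \<and>
        ((\<forall>n. \<exists>y. Phi e x n y) \<longrightarrow>
          (\<forall>\<^sub>F n in sequentially. \<forall>y. Phi e x n y \<longrightarrow> y \<in> ce_seq c n)))"

end

theory Submission
  imports Defs "HOL-Library.Countable"
begin

text \<open>Forcing with computable perfect trees, presented as the images of computable injective maps
  \<open>\<Theta>\<close> of Cantor space into itself in which the first \<open>m\<close> bits of \<open>x\<close> determine the first \<open>m\<close> bits of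
  \<open>\<Theta> x\<close>.  A functional \<open>e\<close> on the tree of \<open>\<Psi>\<close> is the functional \<open>e\<close> with \<open>\<Psi>\<close> substituted for the oracle, on
  the full tree, so only the full tree has to be treated.  There, either some finite string has
  no extension on which \<open>e\<close> converges at some \<open>n\<close>, and one passes to the tree above it, or a search
  thins the tree so that the at most \<open>n\<close> nodes of level \<open>log n\<close> determine the value at \<open>n\<close>.
  The trace then has at most \<open>n\<close> elements.  Iterating over all functionals, with one free bit
  before each step, gives an injection of Cantor space into the traceable reals.\<close>

section \<open>Inversion and determinism of evaluation\<close>

inductive_cases eval_ZeroE: "eval f Zero xs y"
inductive_cases eval_SuccE: "eval f Succ xs y"
inductive_cases eval_ProjE: "eval f (Proj i) xs y"
inductive_cases eval_OrcE: "eval f Orc xs y"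
inductive_cases eval_CompE: "eval f (Comp g hs) xs y"
inductive_cases eval_Prim0E: "eval f (Prim g h) (0 # xs) y"
inductive_cases eval_PrimSE: "eval f (Prim g h) (Suc n # xs) y"
inductive_cases eval_Prim_NilE: "eval f (Prim g h) [] y"
inductive_cases eval_MnE: "eval f (Mn g) xs y"
lemmas eval_elims = eval_ZeroE eval_SuccE eval_ProjE eval_OrcE eval_CompE eval_Prim0E eval_PrimSE eval_MnE

lemma eval_deterministic: "eval f e xs y \<Longrightarrow> eval f e xs z \<Longrightarrow> y = z"
proof (induction arbitrary: z rule: eval.induct)
  case (comp f xs hs ys g y)
  from comp.prems obtain ys' where ys': "list_all2 (\<lambda>h y. eval f h xs y) hs ys'" "eval f g ys' z"
    by (rule eval_CompE)
  have "ys = ys'"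
    using comp.IH(1) ys'(1) by (auto simp: list_all2_conv_all_nth intro!: nth_equalityI)
  then show ?case using comp.IH(2) ys'(2) by simp
next
  case (primS f g h n xs y w)
  from primS.prems obtain y' where "eval f (Prim g h) (n # xs) y'" "eval f h (y' # n # xs) z"
    by (rule eval_PrimSE)
  then show ?case using primS.IH by auto
next
  case (mn f g n xs)
  from mn.prems have z: "eval f g (z # xs) 0" "\<forall>m<z. \<exists>y. y \<noteq> 0 \<and> eval f g (m # xs) y"
    by - (erule eval_MnE, simp)+
  \<comment> \<open>If two searches stopped at different places, the smaller one would carry the
    value zero in one computation and a nonzero value in the other.\<close>
  show ?case
  proof (rule linorder_cases[of n z])
    assume "n < z"
    then show ?thesis using z(2) mn.IH(1) by blast
  next
    assume "z < n"
    then show ?thesis using z(1) mn.IH(2) by blast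
  qed
qed (erule eval_elims; simp)+

section \<open>Total computable functions with an oracle\<close>

text \<open>The code is chosen before the oracle, so this is computability uniform in the oracle.
  Codes carry no arity, hence the parameter \<open>k\<close>.\<close>

definition computes :: "nat \<Rightarrow> ((nat \<Rightarrow> nat) \<Rightarrow> nat list \<Rightarrow> nat) \<Rightarrow> bool" where
  "computes k F \<longleftrightarrow> (\<exists>c. \<forall>x xs. length xs = k \<longrightarrow> eval x c xs (F x xs))"

definition decides :: "nat \<Rightarrow> ((nat \<Rightarrow> nat) \<Rightarrow> nat list \<Rightarrow> bool) \<Rightarrow> bool" where
  "decides k P \<longleftrightarrow> computes k (\<lambda>x xs. of_bool (P x xs))"

lemma computes_cong:
  "computes k F \<Longrightarrow> (\<And>x xs. length xs = k \<Longrightarrow> F x xs = F' x xs) \<Longrightarrow> computes k F'"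
  unfolding computes_def by auto

lemma computes_nth: "i < k \<Longrightarrow> computes k (\<lambda>x xs. xs ! i)"
  unfolding computes_def by (auto intro!: exI[of _ "Proj i"] eval.proj)

text \<open>Recursion and search push new variables onto the front of the argument list, so
  parameters appear behind a \<open>drop\<close>.\<close>

lemma computes_nth_drop: "i + m < k \<Longrightarrow> computes k (\<lambda>x xs. drop m xs ! i)"
  by (rule computes_cong[OF computes_nth[of "m + i"]]) auto

lemma computes_nth_drop_drop:
  "i + m + m' < k \<Longrightarrow> computes k (\<lambda>x xs. drop m (drop m' xs) ! i)"
  using computes_nth_drop[of i "m + m'" k] by (simp add: add.assoc)

text \<open>This is \<open>Comp\<close> with all inner functions at once; weakening and the rules of
  fixed arity below come from it.\<close>

lemma computes_list:
  assumes F: "computes (length As) F" and As: "\<And>A. A \<in> set As \<Longrightarrow> computes k A"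
  shows "computes k (\<lambda>x xs. F x (map (\<lambda>A. A x xs) As))"
proof -
  obtain c where c: "\<And>x xs. length xs = length As \<Longrightarrow> eval x c xs (F x xs)"
    using F unfolding computes_def by auto
  have "\<exists>cs. \<forall>x xs. length xs = k \<longrightarrow> list_all2 (\<lambda>h y. eval x h xs y) cs (map (\<lambda>A. A x xs) As)"
    using As
  proof (induction As)
    case Nil
    show ?case by (intro exI[of _ "[]"]) simp
  next
    case (Cons A As)
    obtain cs where cs: "\<forall>x xs. length xs = k \<longrightarrow> list_all2 (\<lambda>h y. eval x h xs y) cs (map (\<lambda>A. A x xs) As)"
      using Cons by auto
    obtain a where a: "\<forall>x xs. length xs = k \<longrightarrow> eval x a xs (A x xs)"
      using Cons.prems[of A] unfolding computes_def by auto
    show ?case using a cs by (intro exI[of _ "a # cs"]) auto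
  qed
  then obtain cs where
    "\<forall>x xs. length xs = k \<longrightarrow> list_all2 (\<lambda>h y. eval x h xs y) cs (map (\<lambda>A. A x xs) As)" ..
  then have "\<forall>x xs. length xs = k \<longrightarrow> eval x (Comp c cs) xs (F x (map (\<lambda>A. A x xs) As))"
    using c by (auto intro!: eval.comp)
  then show ?thesis unfolding computes_def by blast
qed

lemma computes_drop:
  assumes "computes k A" "l = k + m"
  shows "computes l (\<lambda>x xs. A x (drop m xs))"
proof -
  have "computes l (\<lambda>x xs. A x (map (\<lambda>A. A x xs) (map (\<lambda>i x xs. xs ! (m + i)) [0..<k])))"
    using assms by (intro computes_list) (auto intro: computes_nth)
  then show ?thesis
    by (rule computes_cong) (auto simp: assms intro!: arg_cong[of _ _ "A _"] nth_equalityI)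
qed

lemma computes_app1:
  assumes "computes 1 (\<lambda>x xs. F (xs ! 0))" "computes k A"
  shows "computes k (\<lambda>x xs. F (A x xs))"
  using computes_list[of "[A]" "\<lambda>x xs. F (xs ! 0)" k] assms by simp

lemma computes_app2:
  assumes "computes 2 (\<lambda>x xs. F (xs ! 0) (xs ! 1))" "computes k A" "computes k B"
  shows "computes k (\<lambda>x xs. F (A x xs) (B x xs))"
  using computes_list[of "[A, B]" "\<lambda>x xs. F (xs ! 0) (xs ! 1)" k] assms
  by (auto simp: numeral_2_eq_2)

lemma computes_app3:
  assumes "computes 3 (\<lambda>x xs. F (xs ! 0) (xs ! 1) (xs ! 2))"
    "computes k A" "computes k B" "computes k C"
  shows "computes k (\<lambda>x xs. F (A x xs) (B x xs) (C x xs))"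
  using computes_list[of "[A, B, C]" "\<lambda>x xs. F (xs ! 0) (xs ! 1) (xs ! 2)" k] assms
  by (auto simp: numeral_3_eq_3)

lemma computes_Suc:
  assumes "computes k A" shows "computes k (\<lambda>x xs. Suc (A x xs))"
proof -
  have "computes 1 (\<lambda>x xs. Suc (xs ! 0))"
    unfolding computes_def by (intro exI[of _ Succ]) (auto simp: length_Suc_conv intro: eval.succ)
  from computes_app1[OF this assms] show ?thesis .
qed

lemma computes_oracle:
  assumes "computes k A"
  shows "computes k (\<lambda>x xs. x (A x xs))"
proof -
  have "computes 1 (\<lambda>x xs. x (xs ! 0))"
    unfolding computes_def by (intro exI[of _ Orc]) (auto simp: length_Suc_conv intro: eval.orc)
  then show ?thesis
    using computes_list[of "[A]" "\<lambda>x xs. x (xs ! 0)" k] assms by simp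
qed

lemma computes_const: "computes k (\<lambda>x xs. n)"
proof (induction n)
  case 0
  show ?case unfolding computes_def by (auto intro: eval.zero)
qed (rule computes_Suc)

text \<open>\<open>Prim\<close> hands its step code the previous value, the counter and then the
  parameters, hence the indices 0 and 1 and \<open>drop 2\<close>.\<close>

lemma computes_rec:
  assumes N: "computes k N" and A: "computes k A"
    and B: "computes (k + 2) (\<lambda>x ys. B x (ys ! 1) (ys ! 0) (drop 2 ys))"
  shows "computes k (\<lambda>x xs. rec_nat (A x xs) (\<lambda>n y. B x n y xs) (N x xs))"
proof -
  obtain a where a: "\<And>x xs. length xs = k \<Longrightarrow> eval x a xs (A x xs)"
    using A unfolding computes_def by auto
  obtain b where b: "\<And>x xs. length xs = k + 2 \<Longrightarrow> eval x b xs (B x (xs ! 1) (xs ! 0) (drop 2 xs))"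
    using B unfolding computes_def by auto
  have "eval x (Prim a b) (n # xs) (rec_nat (A x xs) (\<lambda>n y. B x n y xs) n)" if "length xs = k" for x xs n
  proof (induction n)
    case (Suc n)
    show ?case
      using eval.primS[OF Suc b[of "rec_nat (A x xs) (\<lambda>n y. B x n y xs) n # n # xs" x]] that
      by simp
  qed (use a that in \<open>auto intro: eval.prim0\<close>)
  then have "computes (Suc k) (\<lambda>x ys. rec_nat (A x (tl ys)) (\<lambda>n y. B x n y (tl ys)) (hd ys))"
    unfolding computes_def by (intro exI[of _ "Prim a b"]) (auto simp: length_Suc_conv)
  \<comment> \<open>\<open>Prim\<close> recurses on the first argument, so \<open>N\<close> is put
    in front of projections that restore the parameters.\<close>
  then have *: "computes (length (N # map (\<lambda>i x xs. xs ! i) [0..<k]))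
      (\<lambda>x ys. rec_nat (A x (tl ys)) (\<lambda>n y. B x n y (tl ys)) (hd ys))" by simp
  have "computes k A" if "A \<in> set (N # map (\<lambda>i x xs. xs ! i) [0..<k])" for A
    using that N by (auto intro: computes_nth)
  from computes_list[OF * this]
  have "computes k (\<lambda>x xs. rec_nat (A x (map (\<lambda>i. xs ! i) [0..<k]))
      (\<lambda>n y. B x n y (map (\<lambda>i. xs ! i) [0..<k])) (N x xs))"
    by (simp add: comp_def)
  then show ?thesis
  proof (rule computes_cong)
    fix x and xs :: "nat list" assume "length xs = k"
    then have "map ((!) xs) [0..<k] = xs" using map_nth by blast
    then show "rec_nat (A x (map ((!) xs) [0..<k])) (\<lambda>n y. B x n y (map ((!) xs) [0..<k])) (N x xs) =
      rec_nat (A x xs) (\<lambda>n y. B x n y xs) (N x xs)" by (simp only:)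
  qed
qed

lemma computes_add:
  assumes "computes k A" "computes k B" shows "computes k (\<lambda>x xs. A x xs + B x xs)"
proof -
  have "computes k (\<lambda>x xs. rec_nat (A x xs) (\<lambda>n y. Suc y) (B x xs))"
    by (intro computes_rec computes_Suc computes_nth assms) auto
  moreover have "rec_nat a (\<lambda>n y. Suc y) b = a + b" for a b by (induction b) auto
  ultimately show ?thesis by simp
qed

lemma computes_mult:
  assumes "computes k A" "computes k B" shows "computes k (\<lambda>x xs. A x xs * B x xs)"
proof -
  have "computes 2 (\<lambda>x xs. rec_nat 0 (\<lambda>n y. y + (xs ! 0)) (xs ! 1))"
    by (intro computes_rec computes_add computes_nth computes_nth_drop computes_const) auto
  moreover have "rec_nat 0 (\<lambda>n y. y + a) b = a * b" for a b :: nat by (induction b) auto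
  ultimately have "computes 2 (\<lambda>x xs. (xs ! 0) * (xs ! 1))" by simp
  from computes_app2[OF this assms] show ?thesis .
qed

lemma computes_diff:
  assumes "computes k A" "computes k B" shows "computes k (\<lambda>x xs. A x xs - B x xs)"
proof -
  \<comment> \<open>Returning the counter gives the predecessor; iterating that gives truncated
    subtraction.\<close>
  have "computes 1 (\<lambda>x xs. rec_nat 0 (\<lambda>n y. n) (xs ! 0))"
    by (intro computes_rec computes_nth computes_const) auto
  moreover have "rec_nat 0 (\<lambda>n y. n) a = a - 1" for a :: nat by (cases a) auto
  ultimately have pred: "computes 1 (\<lambda>x xs. (xs ! 0) - 1)" by simp
  have "computes k (\<lambda>x xs. rec_nat (A x xs) (\<lambda>n y. y - 1) (B x xs))"
    by (intro computes_rec computes_app1[OF pred] computes_nth assms) auto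
  moreover have "rec_nat a (\<lambda>n y. y - 1) b = a - b" for a b :: nat by (induction b) auto
  ultimately show ?thesis by simp
qed

lemma computes_power:
  assumes "computes k A" shows "computes k (\<lambda>x xs. 2 ^ A x xs)"
proof -
  have "computes k (\<lambda>x xs. rec_nat 1 (\<lambda>n y. y + y) (A x xs))"
    by (intro computes_rec computes_add computes_nth computes_const assms) auto
  moreover have "rec_nat (1 :: nat) (\<lambda>n y. y + y) a = 2 ^ a" for a by (induction a) auto
  ultimately show ?thesis by simp
qed

lemma decides_le:
  assumes "computes k A" "computes k B" shows "decides k (\<lambda>x xs. A x xs \<le> B x xs)"
proof -
  have "computes k (\<lambda>x xs. 1 - (A x xs - B x xs))"
    by (intro computes_diff computes_const assms)
  moreover have "1 - (a - b) = of_bool (a \<le> b)" for a b :: nat by auto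
  ultimately show ?thesis unfolding decides_def by simp
qed

lemma decides_not:
  assumes "decides k P" shows "decides k (\<lambda>x xs. \<not> P x xs)"
proof -
  have "computes k (\<lambda>x xs. 1 - of_bool (P x xs))"
    using assms unfolding decides_def by (intro computes_diff computes_const)
  moreover have "1 - of_bool p = (of_bool (\<not> p) :: nat)" for p by simp
  ultimately show ?thesis unfolding decides_def by simp
qed

lemma decides_conj: "decides k P \<Longrightarrow> decides k Q \<Longrightarrow> decides k (\<lambda>x xs. P x xs \<and> Q x xs)"
  unfolding decides_def of_bool_conj by (rule computes_mult)

lemma decides_disj: "decides k P \<Longrightarrow> decides k Q \<Longrightarrow> decides k (\<lambda>x xs. P x xs \<or> Q x xs)"
  using decides_not[OF decides_conj[OF decides_not decides_not], of k P Q] by simp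

lemma decides_less:
  "computes k A \<Longrightarrow> computes k B \<Longrightarrow> decides k (\<lambda>x xs. A x xs < B x xs)"
  using decides_not[OF decides_le, of k B A] by (simp add: not_le)

lemma decides_eq:
  "computes k A \<Longrightarrow> computes k B \<Longrightarrow> decides k (\<lambda>x xs. A x xs = B x xs)"
  using decides_conj[OF decides_le decides_le, of k A B B A] by (simp add: eq_iff)

lemma decides_ball_less:
  assumes "computes k N" "decides (k + 2) (\<lambda>x ys. P x (ys ! 1) (drop 2 ys))"
  shows "decides k (\<lambda>x xs. \<forall>n<N x xs. P x n xs)"
proof -
  have "computes k (\<lambda>x xs. rec_nat 1 (\<lambda>n y. y * of_bool (P x n xs)) (N x xs))"
    using assms unfolding decides_def
    by (intro computes_rec computes_mult computes_nth computes_const) auto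
  moreover have "rec_nat (1 :: nat) (\<lambda>n y. y * of_bool (Q n)) a = of_bool (\<forall>n<a. Q n)" for a Q
    by (induction a) (auto simp: less_Suc_eq)
  ultimately show ?thesis unfolding decides_def by simp
qed

lemma computes_if:
  assumes "decides k P" "computes k A" "computes k B"
  shows "computes k (\<lambda>x xs. if P x xs then A x xs else B x xs)"
proof -
  have "computes k (\<lambda>x xs. of_bool (P x xs) * A x xs + of_bool (\<not> P x xs) * B x xs)"
    using assms decides_not[of k P] unfolding decides_def
    by (intro computes_add computes_mult)
  then show ?thesis by (rule computes_cong) auto
qed

text \<open>\<open>Mn\<close> looks for a zero, so it is applied to a code for the negation of
  \<open>P\<close>. The halting clause serves for c.e. sets, the value clause for least
  witnesses.\<close>

lemma semidecides_Ex:
  assumes "decides (Suc k) (\<lambda>x ys. P x (ys ! 0) (drop 1 ys))"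
  shows "\<exists>c. \<forall>x xs. length xs = k \<longrightarrow>
    ((\<exists>z. eval x c xs z) \<longleftrightarrow> (\<exists>n. P x n xs)) \<and> ((\<exists>n. P x n xs) \<longrightarrow> eval x c xs (LEAST n. P x n xs))"
proof -
  obtain c where c': "\<And>x ys. length ys = Suc k \<Longrightarrow> eval x c ys (of_bool (\<not> P x (ys ! 0) (drop 1 ys)))"
    using decides_not[OF assms] unfolding decides_def computes_def by blast
  have c: "eval x c (n # xs) (of_bool (\<not> P x n xs))" if "length xs = k" for x xs n
    using c'[of "n # xs"] that by simp
  show ?thesis
  proof (intro exI[of _ "Mn c"] allI impI)
    fix x and xs :: "nat list" assume xs: "length xs = k"
    have 1: "eval x (Mn c) xs (LEAST n. P x n xs)" if "P x n xs" for n
    proof (rule eval.mn)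
      show "eval x c ((LEAST n. P x n xs) # xs) 0"
        using c[OF xs, of x "LEAST n. P x n xs"] LeastI[of "\<lambda>n. P x n xs", OF that] by simp
      show "\<forall>m<LEAST n. P x n xs. \<exists>y. y \<noteq> 0 \<and> eval x c (m # xs) y"
      proof (intro allI impI exI conjI)
        fix m assume "m < (LEAST n. P x n xs)"
        then have "\<not> P x m xs" by (rule not_less_Least)
        then show "eval x c (m # xs) 1" using c[OF xs, of x m] by simp
      qed simp
    qed
    have 2: "P x n xs" if "eval x (Mn c) xs n" for n
    proof -
      have "eval x c (n # xs) 0" using that by (rule eval_MnE)
      from eval_deterministic[OF this c[OF xs]] show ?thesis by (auto split: if_splits)
    qed
    show "((\<exists>z. eval x (Mn c) xs z) \<longleftrightarrow> (\<exists>n. P x n xs)) \<and>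
        ((\<exists>n. P x n xs) \<longrightarrow> eval x (Mn c) xs (LEAST n. P x n xs))"
      using 1 2 by blast
  qed
qed

lemma computes_Least:
  assumes "decides (Suc k) (\<lambda>x ys. P x (ys ! 0) (drop 1 ys))"
    and "\<And>x xs. length xs = k \<Longrightarrow> \<exists>n. P x n xs"
  shows "computes k (\<lambda>x xs. LEAST n. P x n xs)"
proof -
  obtain c where "\<forall>x xs. length xs = k \<longrightarrow> (\<exists>n. P x n xs) \<longrightarrow> eval x c xs (LEAST n. P x n xs)"
    using semidecides_Ex[OF assms(1)] by blast
  then show ?thesis using assms(2) unfolding computes_def by blast
qed

section \<open>Substituting a computable functional for the oracle\<close>

lemma eval_Comp_iff: "eval f (Comp g hs) xs y \<longleftrightarrow>
    (\<exists>ys. list_all2 (\<lambda>h y. eval f h xs y) hs ys \<and> eval f g ys y)"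
  by (blast intro: eval.comp elim: eval_CompE)

lemma eval_Prim_0_iff: "eval f (Prim g h) (0 # xs) y \<longleftrightarrow> eval f g xs y"
  by (blast intro: eval.prim0 elim: eval_Prim0E)

lemma eval_Prim_Suc_iff: "eval f (Prim g h) (Suc n # xs) y \<longleftrightarrow>
    (\<exists>z. eval f (Prim g h) (n # xs) z \<and> eval f h (z # n # xs) y)"
  by (blast intro: eval.primS elim: eval_PrimSE)

lemma eval_Mn_iff: "eval f (Mn g) xs n \<longleftrightarrow>
    eval f g (n # xs) 0 \<and> (\<forall>m<n. \<exists>y. y \<noteq> 0 \<and> eval f g (m # xs) y)"
  by (auto intro!: eval.mn elim!: eval_MnE)

lemma eval_Proj_iff: "eval f (Proj i) xs y \<longleftrightarrow> i < length xs \<and> y = xs ! i"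
  by (auto intro: eval.proj elim: eval_ProjE)

lemma eval_Orc_iff: "eval f Orc xs y \<longleftrightarrow> xs \<noteq> [] \<and> y = f (hd xs)"
  by (cases xs) (auto intro: eval.orc elim: eval_OrcE)

lemma eval_Zero_iff: "eval f Zero xs y \<longleftrightarrow> y = 0"
  by (auto intro: eval.zero elim: eval_ZeroE)

lemma eval_Succ_iff: "eval f Succ xs y \<longleftrightarrow> xs \<noteq> [] \<and> y = Suc (hd xs)"
  by (cases xs) (auto intro: eval.succ elim: eval_SuccE)

text \<open>\<open>Orc\<close> reads the head of a list of any positive length, whereas
  \<open>c\<close> is specified on singletons only; \<open>Proj 0\<close> bridges the two.\<close>

fun subst_oracle :: "recf \<Rightarrow> recf \<Rightarrow> recf" where
  "subst_oracle c Orc = Comp c [Proj 0]"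
| "subst_oracle c (Comp g hs) = Comp (subst_oracle c g) (map (subst_oracle c) hs)"
| "subst_oracle c (Prim g h) = Prim (subst_oracle c g) (subst_oracle c h)"
| "subst_oracle c (Mn g) = Mn (subst_oracle c g)"
| "subst_oracle c e = e"

text \<open>Every oracle query gets its unique answer from \<open>c\<close>, so values and halting
  agree and partial functionals transfer too.\<close>

lemma eval_subst_oracle:
  assumes c: "\<And>n. eval x c [n] (y n)"
  shows "eval x (subst_oracle c e) xs z \<longleftrightarrow> eval y e xs z"
proof (induction e arbitrary: xs z)
  case Orc
  show ?case
    using c eval_deterministic[OF c]
    by (cases xs) (auto simp: eval_Comp_iff eval_Proj_iff eval_Orc_iff list_all2_Cons1)
next
  case (Comp g hs)
  have "list_all2 (\<lambda>h y. eval x h xs y) (map (subst_oracle c) hs) ys \<longleftrightarrow>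
      list_all2 (\<lambda>h z. eval y h xs z) hs ys" for ys
    using Comp by (auto simp: list_all2_conv_all_nth)
  then show ?case using Comp by (simp add: eval_Comp_iff)
next
  case (Prim g h)
  have "eval x (Prim (subst_oracle c g) (subst_oracle c h)) (n # ns) z \<longleftrightarrow> eval y (Prim g h) (n # ns) z" for n ns z
    by (induction n arbitrary: z) (simp_all add: eval_Prim_0_iff eval_Prim_Suc_iff Prim)
  then show ?case
    by (cases xs) (auto elim: eval_Prim_NilE)
qed (simp_all add: eval_Mn_iff eval_Zero_iff eval_Succ_iff eval_Proj_iff)

section \<open>Simulation with a finite oracle\<close>

text \<open>A positive number codes the binary string of its digits below the leading one,
  least significant digit first.  The value \<^term>\<open>0\<close> of \<open>obit\<close> and \<open>sim\<close> stands for undefined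
  and \<^term>\<open>Suc y\<close> for the value \<^term>\<open>y\<close>; the string also bounds all unbounded searches.\<close>

definition obit :: "nat \<Rightarrow> nat \<Rightarrow> nat" where
  "obit w i = (if 2 ^ Suc i \<le> w then Suc (w div 2 ^ i mod 2) else 0)"

text \<open>The accumulator is \<open>0\<close> while searching, \<open>1\<close> after an undefined value, and \<open>n + 2\<close> after
  a zero has been found at \<open>n\<close>.\<close>

definition bsearch :: "(nat \<Rightarrow> nat) \<Rightarrow> nat \<Rightarrow> nat" where
  "bsearch v N = rec_nat 0 (\<lambda>n r. if r = 0 then if v n = 0 then 1 else if v n = 1 then n + 2 else 0 else r) N - 1"

text \<open>In the shifted coding \<open>v n = 1\<close> is the value zero and
  \<open>v m > 1\<close> a defined nonzero value, so this is the rule for \<open>Mn\<close> cut off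
  at \<open>N\<close>.\<close>

lemma bsearch_eq_Suc:
  "bsearch v N = Suc n \<longleftrightarrow> n < N \<and> v n = 1 \<and> (\<forall>m<n. v m > 1)"
proof -
  define R where "R = rec_nat 0 (\<lambda>n r. if r = 0 then if v n = 0 then 1 else if v n = 1 then n + 2 else 0 else r)"
  have R: "R 0 = 0" "R (Suc N) = (if R N = 0 then if v N = 0 then 1 else if v N = 1 then N + 2 else 0 else R N)" for N
    by (auto simp: R_def)
  have R0: "R N = 0 \<longleftrightarrow> (\<forall>m<N. v m > 1)" for N
    by (induction N) (auto simp: R less_Suc_eq)
  have "R N = n + 2 \<longleftrightarrow> n < N \<and> v n = 1 \<and> (\<forall>m<n. v m > 1)" for N n
  proof (induction N)
    case (Suc N)
    then show ?case using R0[of N] by (auto simp: R less_Suc_eq)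
  qed (simp add: R)
  moreover have "r - 1 = Suc n \<longleftrightarrow> r = n + 2" for r by auto
  ultimately show ?thesis unfolding bsearch_def R_def[symmetric] by presburger
qed

fun sim :: "nat \<Rightarrow> recf \<Rightarrow> nat list \<Rightarrow> nat" where
  "sim w Zero xs = 1"
| "sim w Succ xs = (if xs = [] then 0 else Suc (Suc (hd xs)))"
| "sim w (Proj i) xs = (if i < length xs then Suc (xs ! i) else 0)"
| "sim w Orc xs = (if xs = [] then 0 else obit w (hd xs))"
| "sim w (Comp g hs) xs = (if \<forall>h\<in>set hs. sim w h xs \<noteq> 0 then sim w g (map (\<lambda>h. sim w h xs - 1) hs) else 0)"
| "sim w (Prim g h) xs = (case xs of [] \<Rightarrow> 0 | n # ns \<Rightarrow>
    rec_nat (sim w g ns) (\<lambda>n r. if r = 0 then 0 else sim w h ((r - 1) # n # ns)) n)"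
| "sim w (Mn g) xs = bsearch (\<lambda>n. sim w g (n # xs)) w"

text \<open>The inequality is demanded besides agreement of bits because the number itself bounds
  the searches of \<open>sim\<close>.\<close>

definition extends :: "nat \<Rightarrow> nat \<Rightarrow> bool" where
  "extends v w \<longleftrightarrow> v \<le> w \<and> (\<forall>i. obit v i \<noteq> 0 \<longrightarrow> obit w i = obit v i)"

text \<open>A longer string repeats all answers already given and only lengthens the searches, so a
  value once defined persists.\<close>

lemma sim_mono:
  assumes "extends v w"
  shows "sim v e xs = Suc y \<Longrightarrow> sim w e xs = Suc y"
proof (induction e arbitrary: xs y)
  case Orc
  then show ?case using assms by (auto simp: extends_def split: if_splits)
next
  case (Comp g hs)
  have *: "sim w h xs = sim v h xs" if "h \<in> set hs" for h
  proof -
    have "sim v h xs \<noteq> 0" using Comp.prems that by (auto split: if_splits)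
    then show ?thesis using Comp.IH(2)[OF that] by (cases "sim v h xs") auto
  qed
  have "map (\<lambda>h. sim w h xs - 1) hs = map (\<lambda>h. sim v h xs - 1) hs" using * by auto
  moreover have "\<forall>h\<in>set hs. sim v h xs \<noteq> 0" "sim v g (map (\<lambda>h. sim v h xs - 1) hs) = Suc y"
    using Comp.prems by (auto split: if_splits)
  ultimately have "sim w g (map (\<lambda>h. sim w h xs - 1) hs) = Suc y" using Comp.IH(1) by (simp only:)
  then show ?case using * \<open>\<forall>h\<in>set hs. sim v h xs \<noteq> 0\<close> by simp
next
  case (Prim g h)
  have "rec_nat (sim w g ns) (\<lambda>n r. if r = 0 then 0 else sim w h ((r - 1) # n # ns)) n = Suc y"
    if "rec_nat (sim v g ns) (\<lambda>n r. if r = 0 then 0 else sim v h ((r - 1) # n # ns)) n = Suc y" for n ns y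
    using that
  proof (induction n arbitrary: y)
    case (Suc n)
    define r where "r = rec_nat (sim v g ns) (\<lambda>n r. if r = 0 then 0 else sim v h ((r - 1) # n # ns)) n"
    from Suc.prems have r: "r \<noteq> 0" "sim v h ((r - 1) # n # ns) = Suc y"
      by (auto simp: r_def[symmetric] split: if_splits)
    from r(1) have "rec_nat (sim w g ns) (\<lambda>n r. if r = 0 then 0 else sim w h ((r - 1) # n # ns)) n = r"
      using Suc.IH[of "r - 1"] by (simp add: r_def)
    then show ?case using r Prim.IH(2) by simp
  qed (use Prim.IH(1) in simp)
  then show ?case using Prim.prems by (auto split: list.splits)
next
  case (Mn g)
  from Mn.prems have y: "y < v" "sim v g (y # xs) = 1" "\<And>m. m < y \<Longrightarrow> sim v g (m # xs) > 1"
    by (auto simp: bsearch_eq_Suc)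
  have "sim w g (m # xs) = sim v g (m # xs)" if "sim v g (m # xs) > 0" for m
    using Mn.IH that by (cases "sim v g (m # xs)") auto
  with y have "sim w g (y # xs) = 1" "\<And>m. m < y \<Longrightarrow> sim w g (m # xs) > 1" by force+
  with y(1) assms show ?case by (auto simp: bsearch_eq_Suc extends_def)
qed (auto split: if_splits)

text \<open>A converging simulation has used only defined bits, and a bounded search succeeds only
  after seeing defined nonzero values before its zero.\<close>

lemma sim_sound:
  assumes "\<And>i. obit w i \<noteq> 0 \<Longrightarrow> obit w i = Suc (x i)"
  shows "sim w e xs = Suc y \<Longrightarrow> eval x e xs y"
proof (induction e arbitrary: xs y)
  case Orc
  then show ?case using assms[of "hd xs"] by (auto simp: eval_Orc_iff split: if_splits)
next
  case (Comp g hs)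
  from Comp.prems have "\<forall>h\<in>set hs. sim w h xs \<noteq> 0" and g: "sim w g (map (\<lambda>h. sim w h xs - 1) hs) = Suc y"
    by (auto split: if_splits)
  then have "list_all2 (\<lambda>h y. eval x h xs y) hs (map (\<lambda>h. sim w h xs - 1) hs)"
    using Comp.IH(2) by (auto simp: list_all2_conv_all_nth)
  then show ?case using Comp.IH(1)[OF g] by (rule eval.comp)
next
  case (Prim g h)
  have "eval x (Prim g h) (n # ns) y"
    if "rec_nat (sim w g ns) (\<lambda>n r. if r = 0 then 0 else sim w h ((r - 1) # n # ns)) n = Suc y" for n ns y
    using that
  proof (induction n arbitrary: y)
    case (Suc n)
    define r where "r = rec_nat (sim w g ns) (\<lambda>n r. if r = 0 then 0 else sim w h ((r - 1) # n # ns)) n"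
    from Suc.prems have r: "r \<noteq> 0" "sim w h ((r - 1) # n # ns) = Suc y"
      by (auto simp: r_def[symmetric] split: if_splits)
    from r(1) have "eval x (Prim g h) (n # ns) (r - 1)"
      using Suc.IH[of "r - 1"] by (simp add: r_def)
    then show ?case using Prim.IH(2)[OF r(2)] by (rule eval.primS)
  qed (use Prim.IH(1) in \<open>auto intro: eval.prim0\<close>)
  then show ?case using Prim.prems by (auto split: list.splits)
next
  case (Mn g)
  from Mn.prems have y: "sim w g (y # xs) = 1" "\<And>m. m < y \<Longrightarrow> sim w g (m # xs) > 1"
    by (auto simp: bsearch_eq_Suc)
  show ?case
  proof (rule eval.mn, goal_cases)
    case 2
    show ?case
    proof (intro allI impI)
      fix m assume "m < y"
      then have "sim w g (m # xs) = Suc (sim w g (m # xs) - 1)" "sim w g (m # xs) - 1 \<noteq> 0"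
        using y(2)[of m] by auto
      then show "\<exists>y. y \<noteq> 0 \<and> eval x g (m # xs) y" using Mn.IH by blast
    qed
  qed (use y Mn.IH in simp)
qed (auto split: if_splits simp: eval_Zero_iff eval_Succ_iff eval_Proj_iff)

text \<open>A halting computation makes finitely many queries and search steps; each is simulated
  correctly from some stage on, and finitely many such conditions hold together.\<close>

lemma sim_complete:
  assumes W: "\<And>i. \<forall>\<^sub>F j in sequentially. obit (W j) i = Suc (x i)"
  shows "eval x e xs y \<Longrightarrow> \<forall>\<^sub>F j in sequentially. sim (W j) e xs = Suc y"
proof (induction e arbitrary: xs y)
  case (Comp g hs)
  then obtain ys where ys: "list_all2 (\<lambda>h y. eval x h xs y) hs ys" "eval x g ys y"
    by (auto simp: eval_Comp_iff)
  have len: "length hs = length ys" using ys(1) by (rule list_all2_lengthD)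
  have "\<forall>\<^sub>F j in sequentially. \<forall>i\<in>{..<length hs}. sim (W j) (hs ! i) xs = Suc (ys ! i)"
    using ys(1) Comp.IH(2) by (intro eventually_ball_finite) (auto simp: list_all2_conv_all_nth)
  with Comp.IH(1)[OF ys(2)] show ?case
  proof eventually_elim
    case (elim j)
    then have "map (\<lambda>h. sim (W j) h xs - 1) hs = ys"
      using len by (auto intro!: nth_equalityI)
    moreover have "\<forall>h\<in>set hs. sim (W j) h xs \<noteq> 0"
      using elim(2) by (auto simp: in_set_conv_nth)
    ultimately show ?case using elim(1) by simp
  qed
next
  case (Prim g h)
  have "\<forall>\<^sub>F j in sequentially. sim (W j) (Prim g h) (n # ns) = Suc y"
    if "eval x (Prim g h) (n # ns) y" for n ns y
    using that
  proof (induction n arbitrary: y)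
    case (Suc n)
    then obtain z where "eval x (Prim g h) (n # ns) z" "eval x h (z # n # ns) y"
      by (auto simp: eval_Prim_Suc_iff)
    then have "\<forall>\<^sub>F j in sequentially. sim (W j) (Prim g h) (n # ns) = Suc z"
      "\<forall>\<^sub>F j in sequentially. sim (W j) h (z # n # ns) = Suc y"
      using Suc.IH Prim.IH(2) by auto
    then show ?case by eventually_elim simp
  qed (use Prim.IH(1) in \<open>simp add: eval_Prim_0_iff\<close>)
  then show ?case using Prim.prems by (cases xs) (auto elim: eval_Prim_NilE)
next
  case (Mn g)
  then have y: "eval x g (y # xs) 0" and "\<forall>m<y. \<exists>z. z \<noteq> 0 \<and> eval x g (m # xs) z"
    by (auto simp: eval_Mn_iff)
  then obtain z where z: "\<forall>m<y. z m \<noteq> 0 \<and> eval x g (m # xs) (z m)" by metis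
  have "\<forall>\<^sub>F j in sequentially. y < W j"
    using W[of y]
  proof eventually_elim
    case (elim j)
    \<comment> \<open>The leading one stands above all coded bits, so a number that defines bit
      \<open>y\<close> exceeds \<open>y\<close> and suffices as search bound.\<close>
    then have "2 ^ Suc y \<le> W j" by (auto simp: obit_def split: if_splits)
    then show ?case using less_exp[of "Suc y"] by linarith
  qed
  moreover have "\<forall>\<^sub>F j in sequentially. \<forall>m\<in>{..<y}. sim (W j) g (m # xs) = Suc (z m)"
    using z Mn.IH by (intro eventually_ball_finite) auto
  ultimately show ?case using Mn.IH[OF y]
    by eventually_elim (use z in \<open>auto simp: bsearch_eq_Suc\<close>)
qed (use W in \<open>auto simp: eval_Zero_iff eval_Succ_iff eval_Proj_iff eval_Orc_iff\<close>)

section \<open>Computability of the simulator\<close>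

lemma computes_div_power:
  assumes "computes k A" "computes k B"
  shows "computes k (\<lambda>x xs. A x xs div 2 ^ B x xs)"
proof -
  have "a div 2 ^ b = (LEAST q. a < (q + 1) * 2 ^ b)" for a b :: nat
  proof (rule Least_equality[symmetric])
    show "a < (a div 2 ^ b + 1) * 2 ^ b"
      using div_less_iff_less_mult[of "2 ^ b" a "a div 2 ^ b + 1"] by simp
    show "a div 2 ^ b \<le> q" if "a < (q + 1) * 2 ^ b" for q
      using less_mult_imp_div_less[OF that] by simp
  qed
  moreover have "computes 2 (\<lambda>x xs. LEAST q. xs ! 0 < (q + 1) * 2 ^ (xs ! 1))"
  proof (rule computes_Least)
    show "decides (Suc 2) (\<lambda>x ys. drop 1 ys ! 0 < (ys ! 0 + 1) * 2 ^ (drop 1 ys ! 1))"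
      by (intro decides_less computes_mult computes_add computes_power computes_nth computes_nth_drop
          computes_const) auto
    have "a < (a + 1) * 2 ^ b" for a b :: nat
      using mult_le_mono2[of 1 "2 ^ b" "a + 1"] by simp
    then show "\<exists>q. xs ! 0 < (q + 1) * 2 ^ (xs ! 1)" for xs :: "nat list" by blast
  qed
  ultimately have "computes 2 (\<lambda>x xs. xs ! 0 div 2 ^ (xs ! 1))" by simp
  from computes_app2[OF this assms] show ?thesis .
qed

lemma computes_obit:
  assumes "computes k A" "computes k B"
  shows "computes k (\<lambda>x xs. obit (A x xs) (B x xs))"
proof -
  have "a mod 2 = a - 2 * (a div 2 ^ 1)" for a :: nat by (simp add: minus_mult_div_eq_mod)
  then show ?thesis unfolding obit_def
    by (simp only:) (intro computes_if decides_le computes_Suc computes_diff computes_mult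
        computes_div_power computes_power computes_const assms)
qed

text \<open>Since \<open>e\<close> is fixed, induction on it builds a separate code for each
  simulator. The arguments are a list of functions because recursion and search prepend new
  ones.\<close>

lemma computes_sim:
  assumes "computes k W" "\<And>A. A \<in> set As \<Longrightarrow> computes k A"
  shows "computes k (\<lambda>x xs. sim (W x xs) e (map (\<lambda>A. A x xs) As))"
  using assms
proof (induction e arbitrary: k W As)
  case Zero
  show ?case by (simp add: computes_const)
next
  case Succ
  then show ?case by (cases As) (auto intro!: computes_const computes_Suc)
next
  case (Proj i)
  then show ?case by (cases "i < length As") (auto intro: computes_const computes_Suc)
next
  case Orc
  then show ?case by (cases As) (auto intro: computes_const computes_obit)
next
  case (Comp g hs)
  have hs: "computes k (\<lambda>x xs. sim (W x xs) h (map (\<lambda>A. A x xs) As))" if "h \<in> set hs" for h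
    using Comp.IH(2)[OF that] Comp.prems by blast
  then have "decides k (\<lambda>x xs. \<forall>h\<in>set hs. sim (W x xs) h (map (\<lambda>A. A x xs) As) \<noteq> 0)"
  proof (induction hs)
    case Nil
    show ?case by (simp add: decides_def computes_const)
  next
    case (Cons h hs)
    have "decides k (\<lambda>x xs. sim (W x xs) h (map (\<lambda>A. A x xs) As) \<noteq> 0 \<and>
       (\<forall>h\<in>set hs. sim (W x xs) h (map (\<lambda>A. A x xs) As) \<noteq> 0))"
      using Cons by (intro decides_conj decides_not decides_eq computes_const) auto
    then show ?case by simp
  qed
  moreover have "computes k (\<lambda>x xs. sim (W x xs) g
     (map (\<lambda>A. A x xs) (map (\<lambda>h x xs. sim (W x xs) h (map (\<lambda>A. A x xs) As) - 1) hs)))"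
    using Comp.prems hs by (intro Comp.IH(1)) (auto intro!: computes_diff computes_const)
  ultimately show ?case
    by (simp only: sim.simps map_map comp_def) (intro computes_if computes_const)
next
  case (Prim g h)
  show ?case
  proof (cases As)
    case Nil
    then show ?thesis by (simp add: computes_const)
  next
    case (Cons N As')
    have "computes k (\<lambda>x xs. rec_nat (sim (W x xs) g (map (\<lambda>A. A x xs) As'))
       (\<lambda>n r. if r = 0 then 0 else sim (W x xs) h ((r - 1) # n # map (\<lambda>A. A x xs) As')) (N x xs))"
    proof (intro computes_rec)
      show "computes (k + 2) (\<lambda>x ys. if ys ! 0 = 0 then 0 else
        sim (W x (drop 2 ys)) h ((ys ! 0 - 1) # ys ! 1 # map (\<lambda>A. A x (drop 2 ys)) As'))"
      proof (intro computes_if computes_const decides_eq computes_nth)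
        have "computes (k + 2) (\<lambda>x ys. sim (W x (drop 2 ys)) h
          (map (\<lambda>A. A x ys) ((\<lambda>x ys. ys ! 0 - 1) # (\<lambda>x ys. ys ! 1) # map (\<lambda>A x ys. A x (drop 2 ys)) As')))"
          using Prim.prems Cons
          by (intro Prim.IH(2) computes_drop[of k W])
            (auto intro!: computes_diff computes_nth computes_const computes_drop[where k = k and m = 2])
        then show "computes (k + 2) (\<lambda>x ys.
           sim (W x (drop 2 ys)) h ((ys ! 0 - 1) # ys ! 1 # map (\<lambda>A. A x (drop 2 ys)) As'))"
          by (simp add: comp_def)
      qed simp
    qed (use Prim Cons in auto)
    then show ?thesis using Cons by simp
  qed
next
  case (Mn g)
  have *: "computes (k + 2) (\<lambda>x ys. sim (W x (drop 2 ys)) g (ys ! 1 # map (\<lambda>A. A x (drop 2 ys)) As))"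
  proof -
    have "computes (k + 2) (\<lambda>x ys. sim (W x (drop 2 ys)) g
      (map (\<lambda>A. A x ys) ((\<lambda>x ys. ys ! 1) # map (\<lambda>A x ys. A x (drop 2 ys)) As)))"
      using Mn.prems by (intro Mn.IH computes_drop[of k W]) (auto intro!: computes_nth computes_drop[where k = k and m = 2])
    then show ?thesis by (simp add: comp_def)
  qed
  show ?case unfolding sim.simps bsearch_def
    by (intro computes_diff computes_rec computes_if decides_eq computes_add computes_const
        computes_nth Mn.prems *) auto
qed

lemma computes_sim1:
  "computes k W \<Longrightarrow> computes k A \<Longrightarrow> computes k (\<lambda>x xs. sim (W x xs) e [A x xs])"
  using computes_sim[of k W "[A]" e] by auto

section \<open>Paths of a binary tree of finite oracles\<close>

text \<open>For \<open>w > 0\<close> this is the length of the coded string, the integer part of the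
  binary logarithm; \<open>slen 0\<close> is 0.\<close>

definition slen :: "nat \<Rightarrow> nat" where
  "slen w = (LEAST l. w < 2 ^ Suc l)"

text \<open>The leading one of a positive \<open>w\<close> stands at position \<open>slen w\<close>,
  so this is the string of \<open>w\<close> followed by the string of \<open>u + 1\<close>;
  \<open>u = 0\<close> appends nothing.\<close>

definition ext :: "nat \<Rightarrow> nat \<Rightarrow> nat" where
  "ext w u = w + 2 ^ slen w * u"

lemma slen_upper: "w < 2 ^ Suc (slen w)"
  unfolding slen_def
proof (rule LeastI)
  show "w < 2 ^ Suc w" using less_exp[of "Suc w"] by linarith
qed

lemma slen_lower: "2 ^ slen w \<le> w" if "w > 0"
proof (cases "slen w")
  case (Suc l)
  then have "\<not> w < 2 ^ Suc l" unfolding slen_def by (intro not_less_Least) simp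
  with Suc show ?thesis by simp
qed (use that in simp)

lemma slen_geI: "2 ^ l \<le> w \<Longrightarrow> l \<le> slen w"
  using slen_upper[of w] by (metis le_less_trans less_Suc_eq_le nat_power_less_imp_less pos2)

lemma extends_refl: "extends w w"
  by (simp add: extends_def)

lemma extends_trans: "extends u v \<Longrightarrow> extends v w \<Longrightarrow> extends u w"
  unfolding extends_def by (metis le_trans)

text \<open>Defined bits lie below \<open>slen w\<close>, so adding a multiple of
  \<open>2 ^ slen w\<close> changes the shifted number by an even amount.\<close>

lemma extends_ext: "extends w (ext w u)"
  unfolding extends_def
proof (intro conjI allI impI)
  fix i assume "obit w i \<noteq> 0"
  then have i: "2 ^ Suc i \<le> w" by (auto simp: obit_def split: if_splits)
  then obtain k where k: "slen w = Suc i + k" using slen_geI le_Suc_ex by blast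
  have "ext w u = w + 2 ^ i * (2 * (2 ^ k * u))" by (simp add: ext_def k power_add mult_ac)
  then have "ext w u div 2 ^ i = w div 2 ^ i + 2 * (2 ^ k * u)" by simp
  then have "ext w u div 2 ^ i mod 2 = w div 2 ^ i mod 2" by (simp only: mod_mult_self2)
  then show "obit (ext w u) i = obit w i" using i by (simp add: obit_def ext_def)
qed (simp add: ext_def)

lemma ext_Suc_ge: "w > 0 \<Longrightarrow> 2 ^ Suc (slen w) \<le> ext w (Suc u)"
  using slen_lower[of w] by (simp add: ext_def)

text \<open>The appended string is that of \<open>2 * (u + 1) + b\<close>: it begins with
  \<open>b\<close>, and the summand 1 ensures that it is not empty.\<close>

lemma obit_ext:
  assumes "w > 0" "b < 2"
  shows "obit (ext w (2 * u + 1 + b)) (slen w) = Suc b"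
proof -
  define v where "v = w - 2 ^ slen w"
  have w: "w = v + 2 ^ slen w" "v < 2 ^ slen w"
    using slen_lower[OF assms(1)] slen_upper[of w] by (auto simp: v_def)
  have "ext w (2 * u + 1 + b) = v + 2 ^ slen w * (2 * (u + 1) + b)"
    unfolding ext_def using w(1) by (simp add: algebra_simps)
  also have "\<dots> div 2 ^ slen w = 2 * (u + 1) + b"
    using w(2) by (subst div_mult_self2) simp_all
  also have "\<dots> mod 2 = b" using assms(2) by (simp only: mod_mult_self4) simp
  finally show ?thesis
    using ext_Suc_ge[OF assms(1), of "2 * u + b"] by (simp add: obit_def)
qed

text \<open>The second extension acts only above \<open>slen w + m\<close>, so it contributes a
  multiple of \<open>2 ^ m\<close>. With \<open>m = 0\<close> extensions compose; with
  \<open>m = 1\<close> the first appended bit is kept as well.\<close>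

lemma ext_ext:
  assumes "2 ^ (slen w + m) \<le> ext w u"
  obtains v where "ext (ext w u) u' = ext w (2 ^ m * v + u)"
proof -
  from slen_geI[OF assms] obtain k where "slen (ext w u) = slen w + m + k"
    using le_Suc_ex by blast
  then have "ext (ext w u) u' = ext w (2 ^ m * (2 ^ k * u') + u)"
    by (simp add: ext_def[of "ext w u"] power_add) (simp add: ext_def algebra_simps)
  then show ?thesis by (rule that)
qed

lemma computes_slen:
  assumes "computes k A" shows "computes k (\<lambda>x xs. slen (A x xs))"
proof -
  have "computes 1 (\<lambda>x xs. LEAST l. xs ! 0 < 2 ^ Suc l)"
  proof (rule computes_Least)
    show "decides (Suc 1) (\<lambda>x ys. drop 1 ys ! 0 < 2 ^ Suc (ys ! 0))"
      by (intro decides_less computes_power computes_Suc computes_nth computes_nth_drop) auto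
    show "\<exists>l. xs ! 0 < 2 ^ Suc l" for xs :: "nat list"
      using slen_upper by blast
  qed
  from computes_app1[OF this[folded slen_def] assms] show ?thesis .
qed

lemma computes_ext:
  "computes k A \<Longrightarrow> computes k B \<Longrightarrow> computes k (\<lambda>x xs. ext (A x xs) (B x xs))"
  unfolding ext_def by (intro computes_add computes_mult computes_power computes_slen)

text \<open>In the form of \<open>obit_ext\<close>, level \<open>j\<close> appends the direction bit
  \<open>z j\<close> and then the string of \<open>s + 1\<close>, where \<open>s\<close> may depend
  on node, bit and level.\<close>

primrec path :: "(nat \<Rightarrow> nat \<Rightarrow> nat \<Rightarrow> nat) \<Rightarrow> nat \<Rightarrow> (nat \<Rightarrow> nat) \<Rightarrow> nat \<Rightarrow> nat" where
  "path s w z 0 = w"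
| "path s w z (Suc j) = ext (path s w z j) (2 * s (path s w z j) (z j) j + 1 + z j)"

lemma path_cong: "(\<And>i. i < j \<Longrightarrow> z i = z' i) \<Longrightarrow> path s w z j = path s w z' j"
  by (induction j) auto

lemma path_ge: "w > 0 \<Longrightarrow> 2 ^ j \<le> path s w z j"
proof (induction j)
  case (Suc j)
  then have "path s w z j > 0" using zero_less_power[of "2 :: nat" j] by linarith
  have "2 ^ Suc j \<le> (2 :: nat) ^ Suc (slen (path s w z j))"
    using slen_geI Suc by (intro power_increasing) auto
  also have "\<dots> \<le> path s w z (Suc j)"
    using ext_Suc_ge[OF \<open>path s w z j > 0\<close>] by simp
  finally show ?case .
qed simp

lemma path_pos: "w > 0 \<Longrightarrow> path s w z j > 0"
  using path_ge[of w j s z] zero_less_power[of "2 :: nat" j] by linarith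

lemma path_extends: "i \<le> j \<Longrightarrow> extends (path s w z i) (path s w z j)"
  by (induction rule: dec_induct) (auto intro: extends_refl extends_trans extends_ext)

lemma path_eq_ext:
  assumes "w > 0"
  obtains v where "path s w z j = ext w v"
proof -
  have "\<exists>v. path s w z j = ext w v"
  proof (induction j)
    case (Suc j)
    then obtain v where v: "path s w z j = ext w v" ..
    have "2 ^ (slen w + 0) \<le> ext w v" using slen_lower[OF assms] by (simp add: ext_def)
    then show ?case by (metis ext_ext v path.simps(2))
  qed (simp add: exI[of _ 0] ext_def)
  then show ?thesis using that by blast
qed

text \<open>The hypothesis on \<open>Z\<close> has the index at position 1, where the recursion puts
  its counter.\<close>

lemma computes_path:
  assumes s: "computes 3 (\<lambda>x xs. s (xs ! 0) (xs ! 1) (xs ! 2))"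
    and Z: "computes (k + 2) (\<lambda>x ys. Z x (drop 2 ys) (ys ! 1))" and J: "computes k J"
  shows "computes k (\<lambda>x xs. path s w (Z x xs) (J x xs))"
proof -
  have "path s w z j = rec_nat w (\<lambda>j v. ext v (2 * s v (z j) j + 1 + z j)) j" for z j
    by (induction j) auto
  then show ?thesis
    by (simp only:) (intro computes_rec computes_ext computes_add computes_mult computes_app3[OF s]
      computes_const computes_nth Z J; simp)
qed

text \<open>Level \<open>i + 1\<close> has at least \<open>i + 1\<close> bits, so bit
  \<open>i\<close> is defined there; the value 2 of \<open>obit\<close> codes the bit 1.\<close>

definition branch :: "(nat \<Rightarrow> nat \<Rightarrow> nat \<Rightarrow> nat) \<Rightarrow> nat \<Rightarrow> (nat \<Rightarrow> bool) \<Rightarrow> nat \<Rightarrow> bool" where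
  "branch s w x i \<longleftrightarrow> obit (path s w (orac_of x) (Suc i)) i = 2"

lemma orac_of_less: "orac_of x i < 2"
  by (simp add: orac_of_def)

lemma obit_path:
  assumes "w > 0" "i < j"
  shows "obit (path s w (orac_of x) j) i = Suc (orac_of (branch s w x) i)"
proof -
  have "2 ^ Suc i \<le> path s w (orac_of x) (Suc i)" by (rule path_ge[OF assms(1)])
  then have "obit (path s w (orac_of x) (Suc i)) i \<noteq> 0" by (simp add: obit_def)
  moreover have "obit v i \<noteq> 0 \<Longrightarrow> obit v i = Suc (of_bool (obit v i = 2))" for v by (auto simp: obit_def split: if_splits)
  ultimately have "obit (path s w (orac_of x) (Suc i)) i = Suc (orac_of (branch s w x) i)"
    unfolding branch_def orac_of_def of_bool_def by blast
  then show ?thesis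
    using path_extends[of "Suc i" j s w "orac_of x"] assms(2) by (simp add: extends_def)
qed

text \<open>A node of level \<open>j\<close> may define bits beyond \<open>j\<close>; these are
  compared with a later level on the same path.\<close>

lemma obit_path_nonzero:
  assumes "w > 0" "obit (path s w (orac_of x) j) i \<noteq> 0"
  shows "obit (path s w (orac_of x) j) i = Suc (orac_of (branch s w x) i)"
  using obit_path[OF assms(1), of i "max j (Suc i)" s x]
    path_extends[of j "max j (Suc i)" s w "orac_of x"] assms(2)
  by (auto simp: extends_def)

lemma sim_path_sound:
  "w > 0 \<Longrightarrow> sim (path s w (orac_of x) j) e xs = Suc y \<Longrightarrow> eval (orac_of (branch s w x)) e xs y"
  using sim_sound obit_path_nonzero by blast

lemma sim_path_complete:
  assumes "w > 0" "eval (orac_of (branch s w x)) e xs y"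
  obtains j where "sim (path s w (orac_of x) j) e xs = Suc y"
proof -
  have "\<forall>\<^sub>F j in sequentially. sim (path s w (orac_of x) j) e xs = Suc y"
  proof (rule sim_complete[OF _ assms(2)])
    show "\<forall>\<^sub>F j in sequentially. obit (path s w (orac_of x) j) i = Suc (orac_of (branch s w x) i)" for i
      using eventually_gt_at_top[of i] by eventually_elim (rule obit_path[OF assms(1)])
  qed
  then show ?thesis using that eventually_happens trivial_limit_sequentially by blast
qed

definition computable :: "((nat \<Rightarrow> bool) \<Rightarrow> nat \<Rightarrow> bool) \<Rightarrow> bool" where
  "computable \<Theta> \<longleftrightarrow> (\<exists>c. \<forall>x n. eval (orac_of x) c [n] (orac_of (\<Theta> x) n))"

text \<open>This is the Lipschitz condition with constant 1. Prepending a bit turns it into a gain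
  of one bit, which makes infinite composition possible.\<close>

definition nonexpansive :: "((nat \<Rightarrow> 'a) \<Rightarrow> nat \<Rightarrow> 'b) \<Rightarrow> bool" where
  "nonexpansive \<Theta> \<longleftrightarrow> (\<forall>m x y. (\<forall>i<m. x i = y i) \<longrightarrow> (\<forall>i<m. \<Theta> x i = \<Theta> y i))"

definition good :: "((nat \<Rightarrow> bool) \<Rightarrow> nat \<Rightarrow> bool) \<Rightarrow> bool" where
  "good \<Theta> \<longleftrightarrow> inj \<Theta> \<and> nonexpansive \<Theta> \<and> computable \<Theta>"

lemma orac_of_branch: "w > 0 \<Longrightarrow> orac_of (branch s w x) i = obit (path s w (orac_of x) (Suc i)) i - 1"
  using obit_path[of w i "Suc i" s x] by simp

text \<open>Up to the first disagreement \<open>j\<close> both paths pass through the same node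
  \<open>v\<close>; there they append \<open>x j\<close> and \<open>y j\<close>, which differ, as
  bit \<open>slen v\<close>.\<close>

lemma inj_branch: assumes "w > 0" shows "inj (branch s w)"
proof (rule injI, rule ccontr)
  fix x y assume eq: "branch s w x = branch s w y" and "x \<noteq> y"
  then have ex: "\<exists>j. x j \<noteq> y j" by blast
  define j where "j = (LEAST j. x j \<noteq> y j)"
  have j: "x j \<noteq> y j" "\<And>i. i < j \<Longrightarrow> x i = y i"
    using LeastI_ex[OF ex] not_less_Least unfolding j_def by blast+
  define v where "v = path s w (orac_of x) j"
  have v: "v = path s w (orac_of y) j"
    unfolding v_def by (rule path_cong) (simp add: orac_of_def j(2))
  have "v > 0" unfolding v_def by (rule path_pos[OF assms])
  have "orac_of (branch s w x) (slen v) = orac_of x j"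
    using obit_ext[OF \<open>v > 0\<close> orac_of_less, of "s v (orac_of x j) j" x j]
      obit_path_nonzero[OF assms, of s x "Suc j" "slen v"] by (simp add: v_def)
  moreover have "orac_of (branch s w y) (slen v) = orac_of y j"
    using obit_ext[OF \<open>v > 0\<close> orac_of_less, of "s v (orac_of y j) j" y j]
      obit_path_nonzero[OF assms, of s y "Suc j" "slen v"] by (simp add: v)
  ultimately show False using eq j(1) by (auto simp: orac_of_def split: if_splits)
qed

lemma good_branch:
  assumes w: "w > 0" and s: "computes 3 (\<lambda>x xs. s (xs ! 0) (xs ! 1) (xs ! 2))"
  shows "good (branch s w)"
  unfolding good_def nonexpansive_def computable_def
proof (intro conjI allI impI inj_branch w)
  fix m i and x y :: "nat \<Rightarrow> bool" assume "\<forall>i<m. x i = y i" "i < (m :: nat)"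
  \<comment> \<open>Level \<open>i + 1\<close> consults only directions with index at most
    \<open>i\<close>, hence below \<open>m\<close>.\<close>
  then have "path s w (orac_of x) (Suc i) = path s w (orac_of y) (Suc i)"
    by (intro path_cong) (auto simp: orac_of_def less_Suc_eq)
  then show "branch s w x i = branch s w y i" unfolding branch_def by (simp only:)
next
  have "computes 1 (\<lambda>z xs. obit (path s w z (Suc (xs ! 0))) (xs ! 0) - 1)"
    by (intro computes_diff computes_obit computes_path s computes_oracle computes_Suc computes_nth
        computes_const) auto
  then obtain c where "\<And>z n. eval z c [n] (obit (path s w z (Suc n)) n - 1)"
    unfolding computes_def by (metis One_nat_def length_Cons list.size(3) nth_Cons_0)
  then show "\<exists>c. \<forall>x n. eval (orac_of x) c [n] (orac_of (branch s w x) n)"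
    using orac_of_branch[OF w] by auto
qed

section \<open>Forcing a trace\<close>

text \<open>The identity serves as a single bound for all \<open>\<epsilon>\<close>, since it lies
  below \<open>n powr (1 + \<epsilon>)\<close>.\<close>

definition traced :: "recf \<Rightarrow> (nat \<Rightarrow> bool) \<Rightarrow> bool" where
  "traced e x \<longleftrightarrow> (\<exists>c. (\<forall>n. finite (ce_seq c n) \<and> card (ce_seq c n) \<le> n) \<and>
     ((\<forall>n. \<exists>y. Phi e x n y) \<longrightarrow>
        (\<forall>\<^sub>F n in sequentially. \<forall>y. Phi e x n y \<longrightarrow> y \<in> ce_seq c n)))"

text \<open>This indexes the nodes of level \<open>j\<close> by the numbers below
  \<open>2 ^ j\<close>.\<close>

lemma exists_binary_number:
  "(\<And>i. z i < (2 :: nat)) \<Longrightarrow> \<exists>r<2 ^ j. \<forall>i<j. r div 2 ^ i mod 2 = z i"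
proof (induction j arbitrary: z)
  case (Suc j)
  from Suc.IH[of "\<lambda>i. z (Suc i)"] Suc.prems obtain r where
    r: "r < 2 ^ j" "\<And>i. i < j \<Longrightarrow> r div 2 ^ i mod 2 = z (Suc i)" by auto
  have "z 0 + 2 * r < 2 ^ Suc j" using r(1) Suc.prems[of 0] by simp
  moreover have "(z 0 + 2 * r) div 2 ^ i mod 2 = z i" if "i < Suc j" for i
  proof (cases i)
    case 0
    then show ?thesis using Suc.prems[of 0] by simp
  next
    case (Suc i')
    have "(z 0 + 2 * r) div 2 ^ i = (z 0 + 2 * r) div 2 div 2 ^ i'"
      by (simp add: Suc div_mult2_eq)
    also have "(z 0 + 2 * r) div 2 = r" using \<open>\<And>i. z i < 2\<close>[of 0] by simp
    finally show ?thesis using r(2) that Suc by simp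
  qed
  ultimately show ?case by blast
qed simp

text \<open>The arguments are treated one after another; by \<open>sim_mono\<close> later extensions
  keep the convergence already obtained.\<close>

lemma exists_converging_ext:
  assumes conv: "\<And>w n. w > 0 \<Longrightarrow> \<exists>u. sim (ext w u) e [n] \<noteq> 0" and w: "w > 0"
  shows "\<exists>u. \<forall>n<N. sim (ext w u) e [n] \<noteq> 0"
proof (induction N)
  case (Suc N)
  then obtain u where u: "\<forall>n<N. sim (ext w u) e [n] \<noteq> 0" ..
  have "ext w u > 0" using w by (simp add: ext_def)
  from conv[OF this] obtain u' where u': "sim (ext (ext w u) u') e [N] \<noteq> 0" by blast
  have "2 ^ (slen w + 0) \<le> ext w u" using slen_lower[OF w] by (simp add: ext_def)
  then obtain v where v: "ext (ext w u) u' = ext w (2 ^ 0 * v + u)" by (rule ext_ext)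
  have "sim (ext (ext w u) u') e [n] \<noteq> 0" if "n < N" for n
    using u that sim_mono[OF extends_ext, of "ext w u" e "[n]" _ u']
    by (cases "sim (ext w u) e [n]") auto
  with u' have "\<forall>n<Suc N. sim (ext w (2 ^ 0 * v + u)) e [n] \<noteq> 0"
    unfolding v by (auto simp: less_Suc_eq)
  then show ?case by blast
qed simp

text \<open>Every node above \<open>w\<close> leaves \<open>n\<close> undefined, so no branch makes
  \<open>e\<close> total and the empty trace suffices. The zero step function gives the full tree
  above \<open>w\<close>.\<close>

lemma traced_if_diverging:
  assumes w: "w > 0" and div: "\<And>u. sim (ext w u) e [n] = 0"
  shows "traced e (branch (\<lambda>_ _ _. 0) w x)"
proof -
  have "\<not> Phi e (branch (\<lambda>_ _ _. 0) w x) n y" for y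
  proof
    assume "Phi e (branch (\<lambda>_ _ _. 0) w x) n y"
    then obtain j where "sim (path (\<lambda>_ _ _. 0) w (orac_of x) j) e [n] = Suc y"
      unfolding Phi_def by (rule sim_path_complete[OF w])
    moreover obtain u where "path (\<lambda>_ _ _. 0) w (orac_of x) j = ext w u"
      by (rule path_eq_ext[OF w])
    ultimately show False using div by simp
  qed
  \<comment> \<open>Only positions 0 and 1 exist in a list of two arguments, so
    \<open>Proj 2\<close> never halts.\<close>
  moreover have "ce_seq (Proj 2) n = {}" for n
    by (simp add: ce_seq_def eval_Proj_iff)
  ultimately show ?thesis unfolding traced_def by (intro exI[of _ "Proj 2"]) (simp, blast)
qed

text \<open>Level \<open>j + 1\<close> of the tree decides all arguments below \<open>2 ^ (j + 2)\<close>, so the values at \<open>n\<close> are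
  decided at level \<open>slen n\<close>, which has at most \<open>n\<close> nodes.\<close>

definition deciding_step :: "recf \<Rightarrow> nat \<Rightarrow> nat \<Rightarrow> nat \<Rightarrow> nat" where
  "deciding_step e w b j =
     (LEAST u. w = 0 \<or> (\<forall>n<2 ^ (j + 2). sim (ext w (2 * u + 1 + b)) e [n] \<noteq> 0))"

lemma
  assumes conv: "\<And>w n. w > 0 \<Longrightarrow> \<exists>u. sim (ext w u) e [n] \<noteq> 0"
  shows deciding_step: "w > 0 \<Longrightarrow> n < 2 ^ (j + 2) \<Longrightarrow>
      sim (ext w (2 * deciding_step e w b j + 1 + b)) e [n] \<noteq> 0"
    and computes_deciding_step:
      "computes 3 (\<lambda>x xs. deciding_step e (xs ! 0) (xs ! 1) (xs ! 2))"
proof -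
  \<comment> \<open>The disjunct \<open>w = 0\<close> lets the search end on all arguments, as
    \<open>computes_Least\<close> requires; nodes are positive.\<close>
  have ex: "\<exists>u. w = 0 \<or> (\<forall>n<2 ^ (j + 2). sim (ext w (2 * u + 1 + b)) e [n] \<noteq> 0)" for w b j
  proof (cases "w = 0")
    case False
    then have w: "w > 0" by simp
    \<comment> \<open>For a bit \<open>b\<close> this appends \<open>b\<close> alone. A converging
      extension of the result has the required form by \<open>ext_ext\<close> with
      \<open>m = 1\<close>.\<close>
    then have "ext w (Suc b) > 0" by (simp add: ext_def)
    from exists_converging_ext[OF conv this] obtain u where
      u: "\<forall>n<2 ^ (j + 2). sim (ext (ext w (Suc b)) u) e [n] \<noteq> 0" by blast
    have "2 ^ (slen w + 1) \<le> ext w (Suc b)" using ext_Suc_ge[OF w] by simp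
    then obtain v where "ext (ext w (Suc b)) u = ext w (2 ^ 1 * v + Suc b)" by (rule ext_ext)
    with u have "\<forall>n<2 ^ (j + 2). sim (ext w (2 * v + 1 + b)) e [n] \<noteq> 0" by simp
    then show ?thesis by blast
  qed simp
  show "sim (ext w (2 * deciding_step e w b j + 1 + b)) e [n] \<noteq> 0" if "w > 0" "n < 2 ^ (j + 2)"
    using LeastI_ex[OF ex[of w j b]] that unfolding deciding_step_def by blast
  show "computes 3 (\<lambda>x xs. deciding_step e (xs ! 0) (xs ! 1) (xs ! 2))"
    unfolding deciding_step_def
  proof (rule computes_Least[OF _ ex])
    show "decides (Suc 3) (\<lambda>x ys. drop 1 ys ! 0 = 0 \<or> (\<forall>n<2 ^ (drop 1 ys ! 2 + 2).
        sim (ext (drop 1 ys ! 0) (2 * (ys ! 0) + 1 + drop 1 ys ! 1)) e [n] \<noteq> 0))"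
      by (intro decides_disj decides_eq decides_ball_less decides_not computes_sim1 computes_ext
          computes_add computes_mult computes_power computes_nth computes_nth_drop
          computes_nth_drop_drop computes_const) auto
  qed
qed

text \<open>The trace at \<open>n\<close> collects the values decided at level \<open>slen n\<close>
  in the directions given by the binary digits of each \<open>r < n\<close>. These cover the whole
  level because \<open>2 ^ slen n \<le> n\<close> for positive \<open>n\<close>.\<close>

lemma traced_if_converging:
  assumes conv: "\<And>w n. w > 0 \<Longrightarrow> \<exists>u. sim (ext w u) e [n] \<noteq> 0"
  shows "traced e (branch (deciding_step e) 1 x)"
proof -
  define s where "s = deciding_step e"
  define v where "v r n = sim (path s 1 (\<lambda>i. r div 2 ^ i mod 2) (slen n)) e [n]" for r n
  have s: "computes 3 (\<lambda>x xs. s (xs ! 0) (xs ! 1) (xs ! 2))"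
    unfolding s_def by (rule computes_deciding_step[OF conv])
  have mod: "a mod 2 = a - 2 * (a div 2 ^ 1)" for a :: nat by (simp add: minus_mult_div_eq_mod)
  have "decides (Suc 2) (\<lambda>x ys. ys ! 0 < drop 1 ys ! 0 \<and> v (ys ! 0) (drop 1 ys ! 0) = Suc (drop 1 ys ! 1))"
    unfolding v_def mod
    by (intro decides_conj decides_less decides_eq computes_sim1 computes_path s computes_diff
        computes_mult computes_div_power computes_slen computes_Suc computes_nth computes_nth_drop
        computes_nth_drop_drop computes_const) auto
  from semidecides_Ex[OF this] obtain c where
    c: "\<And>x xs. length xs = 2 \<Longrightarrow>
      (\<exists>z. eval x c xs z) \<longleftrightarrow> (\<exists>r. r < xs ! 0 \<and> v r (xs ! 0) = Suc (xs ! 1))" by blast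
  \<comment> \<open>\<open>v\<close> does not depend on the oracle, so \<open>c\<close> can be run
    with the constant zero oracle of \<open>ce_seq\<close>.\<close>
  have U: "ce_seq c n = {y. \<exists>r<n. v r n = Suc y}" for n
    unfolding ce_seq_def using c[of "[n, _]"] by simp
  have sub: "ce_seq c n \<subseteq> (\<lambda>r. v r n - 1) ` {..<n}" for n
    unfolding U by force
  have "finite (ce_seq c n)" "card (ce_seq c n) \<le> n" for n
    using finite_subset[OF sub] surj_card_le[OF _ sub] by auto
  moreover have "y \<in> ce_seq c n" if n: "n \<ge> 2" and y: "Phi e (branch s 1 x) n y" for n y
  proof -
    \<comment> \<open>From \<open>n = 2\<close> on the level is a successor, so at least one
      deciding step has been made.\<close>
    obtain j where j: "slen n = Suc j"
      using slen_geI[of 1 n] n by (cases "slen n") auto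
    obtain r where r: "r < 2 ^ slen n" "\<forall>i<slen n. r div 2 ^ i mod 2 = orac_of x i"
      using exists_binary_number[of "orac_of x"] orac_of_less by blast
    have "path s 1 (\<lambda>i. r div 2 ^ i mod 2) (slen n) = path s 1 (orac_of x) (slen n)"
      using r(2) by (intro path_cong) auto
    then have v: "v r n = sim (path s 1 (orac_of x) (Suc j)) e [n]" by (simp only: v_def j)
    have "n < 2 ^ (j + 2)" using slen_upper[of n] by (simp add: j)
    then have "v r n \<noteq> 0"
      unfolding v path.simps s_def by (intro deciding_step conv path_pos) simp_all
    then obtain y' where y': "v r n = Suc y'" using not0_implies_Suc by blast
    then have "Phi e (branch s 1 x) n y'"
      unfolding v Phi_def by (rule sim_path_sound[OF zero_less_one])
    with y have "y' = y" unfolding Phi_def by (rule eval_deterministic[rotated])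
    moreover have "r < n" using r(1) slen_lower[of n] n by simp
    ultimately show ?thesis using y' U by blast
  qed
  then have "\<forall>\<^sub>F n in sequentially. \<forall>y. Phi e (branch s 1 x) n y \<longrightarrow> y \<in> ce_seq c n"
    by (intro eventually_mono[OF eventually_ge_at_top[of 2]]) blast
  ultimately show ?thesis
    unfolding traced_def s_def[symmetric] by blast
qed

lemma exists_good_traced: "\<exists>\<Theta>. good \<Theta> \<and> (\<forall>x. traced e (\<Theta> x))"
proof (cases "\<exists>w n. w > 0 \<and> (\<forall>u. sim (ext w u) e [n] = 0)")
  case True
  then obtain w n where "w > 0" "\<And>u. sim (ext w u) e [n] = 0" by blast
  then show ?thesis using good_branch[of w "\<lambda>_ _ _. 0"] traced_if_diverging computes_const by blast
next
  case False
  then have "\<And>w n. w > 0 \<Longrightarrow> \<exists>u. sim (ext w u) e [n] \<noteq> 0" by blast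
  then show ?thesis
    using good_branch[of 1 "deciding_step e"] computes_deciding_step traced_if_converging
    by (metis zero_less_one)
qed

lemma exists_good_traced_comp:
  assumes "computable \<Psi>"
  shows "\<exists>\<Theta>. good \<Theta> \<and> (\<forall>x. traced e (\<Psi> (\<Theta> x)))"
proof -
  obtain c where c: "\<And>x n. eval (orac_of x) c [n] (orac_of (\<Psi> x) n)"
    using assms unfolding computable_def by blast
  have "Phi (subst_oracle c e) x = Phi e (\<Psi> x)" for x
    unfolding Phi_def by (intro ext eval_subst_oracle c)
  then have "traced (subst_oracle c e) x \<longleftrightarrow> traced e (\<Psi> x)" for x
    unfolding traced_def by (simp only:)
  then show ?thesis using exists_good_traced[of "subst_oracle c e"] by simp
qed

lemma computableI:
  "computes 1 (\<lambda>z xs. F z (xs ! 0)) \<Longrightarrow> (\<And>x n. F (orac_of x) n = orac_of (\<Theta> x) n) \<Longrightarrow> computable \<Theta>"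
  unfolding computes_def computable_def by (metis One_nat_def length_Cons list.size(3) nth_Cons_0)

lemma computable_comp:
  assumes "computable \<Psi>" "computable \<Theta>" shows "computable (\<Psi> \<circ> \<Theta>)"
proof -
  obtain c d where c: "\<And>x n. eval (orac_of x) c [n] (orac_of (\<Psi> x) n)"
    and d: "\<And>x n. eval (orac_of x) d [n] (orac_of (\<Theta> x) n)"
    using assms unfolding computable_def by blast
  have "eval (orac_of x) (subst_oracle d c) [n] (orac_of ((\<Psi> \<circ> \<Theta>) x) n)" for x n
    by (simp add: eval_subst_oracle[OF d] c)
  then show ?thesis unfolding computable_def by blast
qed

lemma computable_id: "computable id"
  by (rule computableI[where F = "\<lambda>z n. z n"]) (auto intro: computes_oracle computes_nth)

lemma computable_case_nat: "computable (case_nat b)"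
proof (rule computableI)
  show "computes 1 (\<lambda>z xs. if xs ! 0 = 0 then of_bool b else z (xs ! 0 - 1))"
    by (intro computes_if decides_eq computes_oracle computes_diff computes_nth computes_const) auto
  show "(if n = 0 then of_bool b else orac_of x (n - 1)) = orac_of (case_nat b x) n" for x n
    by (cases n) (auto simp: orac_of_def)
qed

lemma exists_backward_orbit:
  fixes \<Theta> :: "nat \<Rightarrow> (nat \<Rightarrow> 'a) \<Rightarrow> nat \<Rightarrow> 'a"
  assumes \<Theta>: "\<And>j m x y. (\<And>i. i < m \<Longrightarrow> x i = y i) \<Longrightarrow> (\<And>i. i < Suc m \<Longrightarrow> \<Theta> j x i = \<Theta> j y i)"
  shows "\<exists>X. \<forall>j. X j = \<Theta> j (X (Suc j))"
proof -
  define C where "C = rec_nat (\<lambda>j x. x) (\<lambda>m r j x. \<Theta> j (r (Suc j) x))"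
  have C: "C 0 j x = x" "C (Suc m) j x = \<Theta> j (C m (Suc j) x)" for m j x
    by (simp_all add: C_def)
  have agree: "C (m + k) j x i = C m j y i" if "i < m" for m k j x y i
    using that
  proof (induction m arbitrary: j i)
    case (Suc m)
    then show ?case using \<Theta>[of m "C (m + k) (Suc j) x" "C m (Suc j) y"] by (simp add: C)
  qed simp
  define X where "X j i = C (Suc i) j undefined i" for j i
  have "X j i = \<Theta> j (X (Suc j)) i" for j i
  proof -
    have "X j i = \<Theta> j (C i (Suc j) undefined) i" by (simp add: X_def C)
    also have "\<dots> = \<Theta> j (X (Suc j)) i"
    proof (rule \<Theta>[of i])
      fix i' assume "i' < i"
      then obtain k where "i = Suc i' + k" using less_iff_Suc_add by auto
      then show "C i (Suc j) undefined i' = X (Suc j) i'"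
        unfolding X_def using agree[of i' "Suc i'" k] by simp
    qed simp
    finally show ?thesis .
  qed
  then show ?thesis by blast
qed

instance recf :: countable
  by countable_datatype

definition refine :: "((nat \<Rightarrow> bool) \<Rightarrow> nat \<Rightarrow> bool) \<Rightarrow> recf \<Rightarrow> (nat \<Rightarrow> bool) \<Rightarrow> nat \<Rightarrow> bool" where
  "refine \<Psi> e = (SOME \<Theta>. good \<Theta> \<and> (\<forall>x. traced e (\<Psi> (\<Theta> x))))"

primrec condition :: "(nat \<Rightarrow> bool) \<Rightarrow> nat \<Rightarrow> (nat \<Rightarrow> bool) \<Rightarrow> nat \<Rightarrow> bool" where
  "condition f 0 = id"
| "condition f (Suc j) =
     (let \<Psi> = condition f j \<circ> case_nat (f j) in \<Psi> \<circ> refine \<Psi> (from_nat j))"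

lemma refine:
  assumes "computable \<Psi>"
  shows "good (refine \<Psi> e)" "traced e (\<Psi> (refine \<Psi> e x))"
  using someI_ex[OF exists_good_traced_comp[OF assms, of e]] unfolding refine_def by blast+

lemma computable_condition: "computable (condition f j)"
proof (induction j)
  case (Suc j)
  then have "computable (condition f j \<circ> case_nat (f j))"
    by (intro computable_comp computable_case_nat)
  with refine(1) show ?case
    unfolding condition.simps Let_def good_def by (blast intro: computable_comp)
qed (use computable_id in \<open>simp add: id_def\<close>)

lemma inj_condition: "inj (condition f j)"
proof (induction j)
  case (Suc j)
  have "inj (refine (condition f j \<circ> case_nat (f j)) (from_nat j))"
    using refine(1) computable_comp computable_condition computable_case_nat unfolding good_def by blast
  moreover have "inj (case_nat b :: (nat \<Rightarrow> bool) \<Rightarrow> _)" for b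
    by (rule injI) (metis ext old.nat.simps(5))
  ultimately show ?case
    unfolding condition.simps Let_def by (intro inj_compose Suc)
qed simp

lemma condition_cong: "(\<And>i. i < j \<Longrightarrow> f i = g i) \<Longrightarrow> condition f j = condition g j"
  by (induction j) (simp_all add: Let_def)

lemma exists_generic:
  obtains X where "\<And>f j. traced (from_nat j) (X f)"
    and "\<And>f j. \<exists>z. X f = condition f j (case_nat (f j) z)"
proof -
  define \<Psi> where "\<Psi> f j = condition f j \<circ> case_nat (f j)" for f j
  define \<Theta> where "\<Theta> f j = refine (\<Psi> f j) (from_nat j)" for f j
  have \<Psi>: "computable (\<Psi> f j)" for f j
    unfolding \<Psi>_def by (intro computable_comp computable_condition computable_case_nat)
  have "\<exists>X. \<forall>j. X j = case_nat (f j) (\<Theta> f j (X (Suc j)))" for f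
  proof (rule exists_backward_orbit)
    fix j m i :: nat and x y :: "nat \<Rightarrow> bool"
    assume eq: "\<And>i. i < m \<Longrightarrow> x i = y i" and "i < Suc m"
    have "nonexpansive (\<Theta> f j)" using refine(1)[OF \<Psi>] by (simp add: \<Theta>_def good_def)
    with eq have "\<Theta> f j x i' = \<Theta> f j y i'" if "i' < m" for i'
      using that unfolding nonexpansive_def by blast
    with \<open>i < Suc m\<close> show "case_nat (f j) (\<Theta> f j x) i = case_nat (f j) (\<Theta> f j y) i"
      by (cases i) auto
  qed
  then obtain X where X: "\<And>f j. X f j = case_nat (f j) (\<Theta> f j (X f (Suc j)))" by metis
  have eq: "X f 0 = condition f j (X f j)" for f j
  proof (induction j)
    case (Suc j)
    then show ?case using X[of f j] by (simp add: Let_def \<Theta>_def \<Psi>_def)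
  qed simp
  then have eq': "X f 0 = \<Psi> f j (\<Theta> f j (X f (Suc j)))" for f j
    by (simp add: \<Psi>_def flip: X)
  show ?thesis
  proof (rule that)
    show "traced (from_nat j) (X f 0)" for f j
      unfolding eq'[of f j] \<Theta>_def by (rule refine(2)[OF \<Psi>])
    show "\<exists>z. X f 0 = condition f j (case_nat (f j) z)" for f j
      using eq'[of f j] by (auto simp: \<Psi>_def)
  qed
qed

lemma jump_traceableI:
  assumes "\<And>e. traced e x" and h: "\<And>n. real n \<le> h n"
  shows "jump_traceable h x"
  unfolding jump_traceable_def
proof
  fix e
  obtain c where "\<And>n. finite (ce_seq c n)" and card: "\<And>n. card (ce_seq c n) \<le> n" and
    "(\<forall>n. \<exists>y. Phi e x n y) \<longrightarrow>
        (\<forall>\<^sub>F n in sequentially. \<forall>y. Phi e x n y \<longrightarrow> y \<in> ce_seq c n)"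
    using assms(1)[of e] unfolding traced_def by blast
  moreover have "real (card (ce_seq c n)) \<le> h n" for n
    using card[of n] h[of n] by linarith
  ultimately show "\<exists>c. (\<forall>n. finite (ce_seq c n) \<and> real (card (ce_seq c n)) \<le> h n) \<and>
      ((\<forall>n. \<exists>y. Phi e x n y) \<longrightarrow>
        (\<forall>\<^sub>F n in sequentially. \<forall>y. Phi e x n y \<longrightarrow> y \<in> ce_seq c n))" by blast
qed

theorem mainTheorem9:
  fixes \<epsilon> :: rat
  assumes "\<epsilon> > 0"
  shows "{x :: nat \<Rightarrow> bool. jump_traceable (\<lambda>n. real n powr (1 + of_rat \<epsilon>)) x}
           \<approx> (UNIV :: (nat \<Rightarrow> bool) set)"
proof (rule lepoll_antisym)
  show "{x :: nat \<Rightarrow> bool. jump_traceable (\<lambda>n. real n powr (1 + of_rat \<epsilon>)) x} \<lesssim> (UNIV :: (nat \<Rightarrow> bool) set)"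
    by (rule subset_imp_lepoll) simp
  have h: "real n \<le> real n powr (1 + of_rat \<epsilon>)" for n
  proof (cases "n = 0")
    case False
    then have "real n powr 1 \<le> real n powr (1 + of_rat \<epsilon>)"
      using assms by (intro powr_mono) auto
    then show ?thesis using False by simp
  qed simp
  obtain X where X: "\<And>f j. traced (from_nat j) (X f)"
    "\<And>f j. \<exists>z. X f = condition f j (case_nat (f j) z)" using exists_generic by blast
  have "inj X"
  proof (rule injI, rule ccontr)
    fix f g assume eq: "X f = X g" and "f \<noteq> g"
    then have ex: "\<exists>j. f j \<noteq> g j" by blast
    define j where "j = (LEAST j. f j \<noteq> g j)"
    have j: "f j \<noteq> g j" "\<And>i. i < j \<Longrightarrow> f i = g i"
      using LeastI_ex[OF ex] not_less_Least unfolding j_def by blast+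
    obtain z z' where "X f = condition f j (case_nat (f j) z)" "X g = condition g j (case_nat (g j) z')"
      using X(2) by meson
    then have "case_nat (f j) z = case_nat (g j) z'"
      using eq condition_cong[of j f g, OF j(2)] inj_condition[of g j] by (simp add: inj_eq)
    from fun_cong[OF this, of 0] j(1) show False by simp
  qed
  moreover have "traced e (X f)" for e f
    using X(1)[where j = "to_nat e"] by simp
  then have "X f \<in> {x. jump_traceable (\<lambda>n. real n powr (1 + of_rat \<epsilon>)) x}" for f
    using h by (auto intro: jump_traceableI)
  ultimately show "(UNIV :: (nat \<Rightarrow> bool) set) \<lesssim>
      {x. jump_traceable (\<lambda>n. real n powr (1 + of_rat \<epsilon>)) x}"
    unfolding lepoll_def by blast
qed

end
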